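(* Let $f:2^V\to\mathbb{R}_{\ge0}$ be a monotone submodular performance metric, $\eta\ge0$, and $k$ a positive integer. Consider $$\text{maximize}_{S\subseteq V}\ f(S)+\eta(c_1(S)+c_2(S))\quad\text{s.t.}\quad|S|\le k,$$ and let $S^{\ast}$ be an optimal solution. Let $S$ be the set obtained by the greedy algorithm that starts from $S=\emptyset$ and, in each of $k$ iterations, adds to $S$ an element $v\in V$ maximizing $f(S\cup\{v\})+\eta(c_1(S\cup\{v\})+c_2(S\cup\{v\}))$. Then $$f(S)+\eta(c_1(S)+c_2(S))\ \ge\ (1-1/e)\bigl(f(S^{\ast})+\eta(c_1(S^{\ast})+c_2(S^{\ast}))\bigr).$$
   Context: **System.** $V=\{1,\dots,n\}$ indexes the states of $F\dot{\mathbf{x}}(t)=A\mathbf{x}(t)$, where $F=Q_F+T_F$, $A=Q_A+T_A$ are $n\times n$; $Q_F,Q_A$ are known fixed real matrices and $T_F,T_A$ are structure matrices: their nonzero entries are independent free parameters that can take any real value. The system is assumed solvable: for every initial state there is a unique trajectory. For an input set $S\subseteq V$, the controlled system is represented as $F\dot{\mathbf{x}}=A\mathbf{x}+B\mathbf{u}$ with $B=T_B(S)$, the $n\times n$ diagonal matrix with a free parameter in the $i$-th diagonal entry for $i\in S$ and zeros elsewhere. **First graph controllability index.** $c_1(S)=\max\{|V'|: V'\subseteq V,\ \mathrm{rank}(A(V')\,|\,B(V'))=|V'|\}$, where $A(V'),B(V')$ are the submatrices of $A,B$ consisting of the rows and columns indexed in $V'$, and rank is understood for generic values of the free parameters. **Auxiliary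 graph.** Let $\Omega=\begin{pmatrix}Q_A-Q_F\\ I\end{pmatrix}$, with rows indexed $w_1,\dots,w_n,x_1,\dots,x_n$. Say $(i,j)\in T$ if the $(i,j)$ entry of $T_A$ or $T_F$ is nonzero. Let $H$ be the bipartite graph with sides $\{w_i^T\}$ and $\{w_i^Q\}\cup\{x_i^Q\}$ and edges $(w_i^T,w_i^Q)$ for all $i$, and $(w_i^T,x_j^Q)$ for $(i,j)\in T$. By solvability there is a matching $m$ of $H$ matching all $w_i^T$ such that the rows in $J=\{w_i:m(w_i^T)=w_i^Q\}\cup\{x_j: m(w_i^T)=x_j^Q\text{ for some }i\}$ are linearly independent in $\Omega$; fix such an $m$. Let $\Omega_J$ be the submatrix of rows $J$ and $\tilde\Omega=\Omega\Omega_J^{-1}$, with columns indexed by $J$. $G'$ is the directed graph with vertices $w_i^T,w_i^Q,x_i^T,x_i^Q$ ($i=1,\dots,n$) and edges: $w_i^T\to x_j^Q$ if $(i,j)\in T$, $m(w_i^T)\ne x_j^Q$; $x_j^Q\to w_i^T$ if $(i,j)\in T$, $m(w_i^T)=x_j^Q$; $w_i^T\to w_i^Q$ if $m(w_i^T)\neq w_i^Q$; $w_i^Q\to w_i^T$ if $m(w_i^T)=w_i^Q$; $a^Q\to b^Q$ for $a\notin J$, $b\in J$, $\tilde\Omega_{ab}\ne0$. For input set $S$, $\hat G$ is $G'$ with additional vertices $u_i^T,u_i^Q$ and edges $w_i^T\to u_i^T$, $u_i^T\to u_i^Q$ for $i\in S$. **Second graph controllability index.** $c_2(S)=|\{i\in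 V: i\text{ is reachable to }\mathbf{u}\text{ in }\hat G\}|$, i.e. (identifying $i$ with the vertex $w_i^T$) the number of $i\in V$ from which there is a directed path in $\hat G$ to some $u_j^Q$, $j\in S$. *)

theory Defs
  imports "HOL-Analysis.Analysis"
begin

section \<open>Structured systems with generic parameters\<close>

text \<open>The state set \<open>V\<close> is the finite type \<open>'n\<close>. A structure matrix is given by the set \<open>P\<close> of
  positions of its free parameters together with a parameter assignment; assigned values outside
  \<open>P\<close> are ignored.\<close>

definition structured :: "('n::finite \<times> 'n) set \<Rightarrow> real^'n^'n \<Rightarrow> real^'n^'n" where
  "structured P \<theta> = (\<chi> i j. if (i, j) \<in> P then \<theta> $ i $ j else 0)"

definition input_matrix :: "'n::finite set \<Rightarrow> real^'n \<Rightarrow> real^'n^'n" where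
  "input_matrix S \<beta> = (\<chi> i j. if i = j \<and> i \<in> S then \<beta> $ i else 0)"

text \<open>A property of the parameters holds generically if it holds off the zero set of some nonzero
  polynomial in the parameters. Unused coordinates of the parameter space (positions outside the
  patterns) do not affect this notion.\<close>

definition generically :: "('p::real_normed_vector \<Rightarrow> bool) \<Rightarrow> bool" where
  "generically P \<longleftrightarrow>
     (\<exists>p. real_polynomial_function p \<and> (\<exists>\<theta>. p \<theta> \<noteq> 0) \<and> (\<forall>\<theta>. p \<theta> \<noteq> 0 \<longrightarrow> P \<theta>))"

definition trajectory :: "real^'n^'n::finite \<Rightarrow> real^'n^'n \<Rightarrow> (real \<Rightarrow> real^'n) \<Rightarrow> bool" where
  "trajectory F A x \<longleftrightarrow>
     (\<exists>x'. \<forall>t\<ge>0. (x has_vector_derivative x' t) (at t within {0..}) \<and> F *v x' t = A *v x t)"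

text \<open>Trajectories live on the time axis \<open>t \<ge> 0\<close>, so uniqueness is agreement there.\<close>

definition solvable_pair :: "real^'n^'n::finite \<Rightarrow> real^'n^'n \<Rightarrow> bool" where
  "solvable_pair F A \<longleftrightarrow>
     (\<forall>x0. (\<exists>x. trajectory F A x \<and> x 0 = x0) \<and>
           (\<forall>x y. trajectory F A x \<and> x 0 = x0 \<and> trajectory F A y \<and> y 0 = x0
              \<longrightarrow> (\<forall>t\<ge>0. x t = y t)))"

definition solvable ::
  "real^'n^'n::finite \<Rightarrow> ('n \<times> 'n) set \<Rightarrow> real^'n^'n \<Rightarrow> ('n \<times> 'n) set \<Rightarrow> bool" where
  "solvable QF PF QA PA \<longleftrightarrow>
     generically (\<lambda>(\<theta>F :: real^'n^'n, \<theta>A :: real^'n^'n).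
       solvable_pair (QF + structured PF \<theta>F) (QA + structured PA \<theta>A))"


section \<open>First graph controllability index\<close>

text \<open>\<open>(A(V') | B(V'))\<close>, with the rows and columns outside \<open>V'\<close> replaced by zero instead of being
  deleted; this does not change the rank and avoids a type depending on \<open>V'\<close>.\<close>

definition joint_submatrix ::
  "'n::finite set \<Rightarrow> real^'n^'n \<Rightarrow> real^'n^'n \<Rightarrow> real^('n + 'n)^'n" where
  "joint_submatrix V' A B =
     (\<chi> i c. case c of
        Inl j \<Rightarrow> if i \<in> V' \<and> j \<in> V' then A $ i $ j else 0
      | Inr j \<Rightarrow> if i \<in> V' \<and> j \<in> V' then B $ i $ j else 0)"

definition c1 :: "real^'n^'n::finite \<Rightarrow> ('n \<times> 'n) set \<Rightarrow> 'n set \<Rightarrow> nat" where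
  "c1 QA PA S =
     Max {card V' | V'. generically (\<lambda>(\<theta>A :: real^'n^'n, \<beta> :: real^'n).
            rank (joint_submatrix V' (QA + structured PA \<theta>A) (input_matrix S \<beta>)) = card V')}"


section \<open>Auxiliary graph and second graph controllability index\<close>

text \<open>Row index \<open>Inl i\<close> stands for \<open>w\<^sub>i\<close> and \<open>Inr i\<close> for \<open>x\<^sub>i\<close>.\<close>

definition Omega :: "real^'n^'n::finite \<Rightarrow> real^'n^'n \<Rightarrow> real^'n^('n + 'n)" where
  "Omega QF QA =
     (\<chi> a. case a of Inl i \<Rightarrow> row i (QA - QF) | Inr i \<Rightarrow> row i (mat 1))"

text \<open>A matching of \<open>H\<close> covering all \<open>w\<^sub>i\<^sup>T\<close> is an injective map \<open>m\<close> sending \<open>i\<close> to the index of the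
  \<open>Q\<close>-vertex matched with \<open>w\<^sub>i\<^sup>T\<close>; thus \<open>J = range m\<close>. The argument \<open>T\<close> is the union of the
  patterns of \<open>T\<^sub>A\<close> and \<open>T\<^sub>F\<close>.\<close>

definition H_edges :: "('n \<times> 'n) set \<Rightarrow> ('n \<times> ('n + 'n)) set" where
  "H_edges T = {(i, Inl i) | i. True} \<union> {(i, Inr j) | i j. (i, j) \<in> T}"

definition admissible_matching ::
  "real^'n^'n::finite \<Rightarrow> real^'n^'n \<Rightarrow> ('n \<times> 'n) set \<Rightarrow> ('n \<Rightarrow> 'n + 'n) \<Rightarrow> bool" where
  "admissible_matching QF QA T m \<longleftrightarrow>
     (\<forall>i. (i, m i) \<in> H_edges T) \<and> inj m \<and>
     inj_on (\<lambda>a. row a (Omega QF QA)) (range m) \<and>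
     independent ((\<lambda>a. row a (Omega QF QA)) ` range m)"

text \<open>The index set \<open>J\<close> is enumerated by \<open>m\<close>: row \<open>i\<close> of \<open>Omega_J\<close>, and column \<open>i\<close> of
  \<open>Omega_tilde\<close>, belong to the element \<open>m i\<close> of \<open>J\<close>.\<close>

definition Omega_J ::
  "real^'n^'n::finite \<Rightarrow> real^'n^'n \<Rightarrow> ('n \<Rightarrow> 'n + 'n) \<Rightarrow> real^'n^'n" where
  "Omega_J QF QA m = (\<chi> i. row (m i) (Omega QF QA))"

definition Omega_tilde ::
  "real^'n^'n::finite \<Rightarrow> real^'n^'n \<Rightarrow> ('n \<Rightarrow> 'n + 'n) \<Rightarrow> real^'n^('n + 'n)" where
  "Omega_tilde QF QA m = Omega QF QA ** matrix_inv (Omega_J QF QA m)"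

datatype 'n vertex = WT 'n | WQ 'n | XT 'n | XQ 'n | UT 'n | UQ 'n

fun Q_vertex :: "'n + 'n \<Rightarrow> 'n vertex" where
  "Q_vertex (Inl i) = WQ i"
| "Q_vertex (Inr i) = XQ i"

definition G'_edges ::
  "real^'n^'n::finite \<Rightarrow> real^'n^'n \<Rightarrow> ('n \<times> 'n) set \<Rightarrow> ('n \<Rightarrow> 'n + 'n) \<Rightarrow> 'n vertex rel" where
  "G'_edges QF QA T m =
     {(WT i, XQ j) | i j. (i, j) \<in> T \<and> m i \<noteq> Inr j} \<union>
     {(XQ j, WT i) | i j. (i, j) \<in> T \<and> m i = Inr j} \<union>
     {(WT i, WQ i) | i. m i \<noteq> Inl i} \<union>
     {(WQ i, WT i) | i. m i = Inl i} \<union>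
     {(Q_vertex a, Q_vertex (m i)) | a i. a \<notin> range m \<and> Omega_tilde QF QA m $ a $ i \<noteq> 0}"

definition Ghat_edges ::
  "real^'n^'n::finite \<Rightarrow> real^'n^'n \<Rightarrow> ('n \<times> 'n) set \<Rightarrow> ('n \<Rightarrow> 'n + 'n) \<Rightarrow> 'n set
     \<Rightarrow> 'n vertex rel" where
  "Ghat_edges QF QA T m S =
     G'_edges QF QA T m \<union> {(WT i, UT i) | i. i \<in> S} \<union> {(UT i, UQ i) | i. i \<in> S}"

definition c2 ::
  "real^'n^'n::finite \<Rightarrow> real^'n^'n \<Rightarrow> ('n \<times> 'n) set \<Rightarrow> ('n \<Rightarrow> 'n + 'n) \<Rightarrow> 'n set \<Rightarrow> nat" where
  "c2 QF QA T m S = card {i. \<exists>j\<in>S. (WT i, UQ j) \<in> (Ghat_edges QF QA T m S)\<^sup>*}"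


section \<open>Cardinality-constrained maximization\<close>

definition submodular :: "('n set \<Rightarrow> real) \<Rightarrow> bool" where
  "submodular f \<longleftrightarrow> (\<forall>X Y. f (X \<union> Y) + f (X \<inter> Y) \<le> f X + f Y)"

definition optimal_solution :: "('n set \<Rightarrow> real) \<Rightarrow> nat \<Rightarrow> 'n set \<Rightarrow> bool" where
  "optimal_solution g k S \<longleftrightarrow> card S \<le> k \<and> (\<forall>X. card X \<le> k \<longrightarrow> g X \<le> g S)"

text \<open>\<open>greedy g k S\<close>: \<open>S\<close> is a possible result of \<open>k\<close> greedy iterations, with ties broken
  arbitrarily. The maximizer ranges over all of \<open>V\<close>, including elements already chosen.\<close>

inductive greedy :: "('n set \<Rightarrow> real) \<Rightarrow> nat \<Rightarrow> 'n set \<Rightarrow> bool" for g where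
  greedy_0: "greedy g 0 {}"
| greedy_Suc: "greedy g k S \<Longrightarrow> (\<And>w. g (insert w S) \<le> g (insert v S))
     \<Longrightarrow> greedy g (Suc k) (insert v S)"

end

theory Submission
  imports Defs
begin

text \<open>The greedy bound holds for every nonnegative, monotone, submodular objective, so the matter is
  to show that both indices are monotone and submodular.

  The second index is a coverage function: the vertices \<open>u\<^sub>j\<close> are reached only through \<open>w\<^sub>j\<^sup>T\<close>, so
  it counts the union over \<open>j \<in> S\<close> of the sets of states from which \<open>w\<^sub>j\<^sup>T\<close> is reachable in the graph
  without inputs, and this graph does not depend on \<open>S\<close> (lemma \<open>c2_eq\<close>).

  The first index is the dimension of a sum of subspaces (lemma \<open>c1_eq_dim\<close>). For a matrix \<open>M\<close> let
  \<open>R\<^sub>S\<close> be the largest subspace \<open>X\<close> with \<open>X = M X + span {e\<^sub>j | j \<in> S}\<close>. With \<open>L > n\<close> it is the span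
  of the image of \<open>M\<^sup>L\<close> and of all \<open>M\<^sup>k e\<^sub>j\<close> with \<open>j \<in> S\<close> and \<open>k < L\<close>. Therefore
  \<open>R\<^bsub>S \<union> T\<^esub> = R\<^sub>S + R\<^sub>T\<close> and \<open>R\<^bsub>S \<inter> T\<^esub> \<subseteq> R\<^sub>S \<inter> R\<^sub>T\<close>, and the dimension formula gives submodularity of
  \<open>dim R\<^sub>S\<close>. If \<open>M = D A\<close> with \<open>D\<close> a generic diagonal matrix and \<open>A\<close> a generic realization of the
  state matrix, then \<open>dim R\<^sub>S\<close> is the first index, for all \<open>S\<close> at once:

  \<^item> (\<open>dim_fitting_space_le_rank\<close>) For every \<open>D\<close> and \<open>A\<close> the dimension of \<open>R\<^sub>S\<close> is at most the index.
    Some matrix \<open>N\<close> that differs from \<open>M\<close> only in the rows of \<open>S\<close> maps \<open>R\<^sub>S\<close> onto itself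
    (\<open>bijective_feedback\<close>). Then \<open>det (I + x N)\<close> has degree at least \<open>dim R\<^sub>S\<close> in \<open>x\<close>
    (\<open>degree_minor_poly_ge\<close>). Its coefficients are sums of principal minors, so \<open>N\<close> has a nonzero
    principal minor of at least this size. Its rows outside \<open>S\<close> are rows of \<open>M\<close>, and they show
    that its index set is feasible for the first index.

  \<^item> (\<open>card_le_dim_fitting_space\<close>) For a feasible set \<open>V'\<close> let \<open>D\<close> be the projection onto the
    coordinates in \<open>W = V' \<union> S\<close>. The rank condition says that \<open>span {e\<^sub>i | i \<in> W}\<close> is contained in
    its image under \<open>M\<close> plus \<open>span {e\<^sub>j | j \<in> S}\<close>, hence in \<open>R\<^sub>S\<close>. So \<open>dim R\<^sub>S \<ge> |V'|\<close>.

  \<^item> (\<open>generically_dim_ge\<close>) The condition that \<open>dim R\<^sub>S\<close> is at least the index holds generically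
    once it holds at one point. There are finitely many \<open>S\<close>, so one choice of \<open>D\<close> and \<open>A\<close> serves
    all of them.\<close>

section \<open>Generic properties\<close>

lemma real_polynomial_function_mult_nonzero:
  fixes p q :: "'a::real_normed_vector \<Rightarrow> real"
  assumes p: "real_polynomial_function p" "p a \<noteq> 0"
    and q: "real_polynomial_function q" "q b \<noteq> 0"
  shows "\<exists>c. p c * q c \<noteq> 0"
proof -
  define line where "line t = a + t *\<^sub>R (b - a)" for t :: real
  have "bounded_linear (\<lambda>t::real. t *\<^sub>R (b - a))"
    by (intro bounded_linear_intros)
  then have line: "polynomial_function line"
    unfolding line_def by (intro polynomial_function_add polynomial_function_const
        polynomial_function_bounded_linear)
  (* On the line through a and b both polynomials have finitely many zeros. *)
  have fin: "finite {t. r (line t) = 0}" if r: "real_polynomial_function r" "r (line s) \<noteq> 0"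
    for r :: "'a \<Rightarrow> real" and s
  proof -
    have "real_polynomial_function (r \<circ> line)"
      by (rule real_polynomial_function_compose[OF line r(1)])
    then obtain c n where c: "r \<circ> line = (\<lambda>t. \<Sum>i\<le>n. c i * t ^ i)"
      using real_polynomial_function_imp_sum by blast
    have eq: "r (line t) = (\<Sum>i\<le>n. c i * t ^ i)" for t
      using fun_cong[OF c, of t] by simp
    have "\<exists>i\<le>n. c i \<noteq> 0"
      using r(2) unfolding eq by (metis (no_types, lifting) atMost_iff mult_zero_left sum.neutral)
    then show ?thesis
      unfolding eq by (rule polyfun_finite_roots[THEN iffD2])
  qed
  have "finite {t. p (line t) = 0}" "finite {t. q (line t) = 0}"
    using fin[OF p(1), of 0] fin[OF q(1), of 1] p(2) q(2) by (simp_all add: line_def)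
  then have "finite ({t. p (line t) = 0} \<union> {t. q (line t) = 0})" by simp
  then obtain t where "t \<notin> {t. p (line t) = 0} \<union> {t. q (line t) = 0}"
    using infinite_UNIV_char_0[where 'a = real] by (metis UNIV_eq_I)
  then show ?thesis by (intro exI[of _ "line t"]) simp
qed

lemma generically_True: "generically (\<lambda>_ :: 'p::real_normed_vector. True)"
  unfolding generically_def
  by (intro exI[of _ "\<lambda>_. 1"]) (auto intro: real_polynomial_function.intros(2))

lemma generically_mono:
  assumes "generically P" "\<And>\<theta>. P \<theta> \<Longrightarrow> Q \<theta>"
  shows "generically Q"
  using assms unfolding generically_def by blast

lemma generically_conj:
  assumes "generically P" "generically Q"
  shows "generically (\<lambda>\<theta>. P \<theta> \<and> Q \<theta>)"
proof -
  obtain p a where p: "real_polynomial_function p" "p a \<noteq> 0" "\<And>\<theta>. p \<theta> \<noteq> 0 \<Longrightarrow> P \<theta>"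
    using assms(1) unfolding generically_def by blast
  obtain q b where q: "real_polynomial_function q" "q b \<noteq> 0" "\<And>\<theta>. q \<theta> \<noteq> 0 \<Longrightarrow> Q \<theta>"
    using assms(2) unfolding generically_def by blast
  obtain c where c: "p c * q c \<noteq> 0"
    using real_polynomial_function_mult_nonzero[OF p(1,2) q(1,2)] by blast
  show ?thesis
    unfolding generically_def
    by (intro exI[of _ "\<lambda>\<theta>. p \<theta> * q \<theta>"])
       (use c p q in \<open>auto intro!: real_polynomial_function.intros(4)\<close>)
qed

lemma generically_finite_Ball:
  assumes "finite X" "\<And>x. x \<in> X \<Longrightarrow> generically (P x)"
  shows "generically (\<lambda>\<theta>. \<forall>x\<in>X. P x \<theta>)"
  using assms by (induction X rule: finite_induct) (simp_all add: generically_True generically_conj)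

lemma generically_ex: "generically P \<Longrightarrow> \<exists>\<theta>. P \<theta>"
  unfolding generically_def by blast

lemma real_polynomial_function_det:
  fixes M :: "'p::real_normed_vector \<Rightarrow> real^'n^'n"
  assumes "\<And>i j. real_polynomial_function (\<lambda>\<theta>. M \<theta> $ i $ j)"
  shows "real_polynomial_function (\<lambda>\<theta>. det (M \<theta>))"
  unfolding det_def
  by (intro real_polynomial_function_sum real_polynomial_function.intros(4)
      real_polynomial_function.intros(2) real_polynomial_function_prod assms finite_permutations finite)

lemma det_nonzero_imp_independent_rows:
  fixes A :: "real^'n^'n"
  assumes "det A \<noteq> 0"
  shows "inj (\<lambda>i. row i A)" "independent ((\<lambda>i. row i A) ` X)"
proof -
  show "inj (\<lambda>i. row i A)"
    using assms det_identical_rows by (metis injI)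
  have "independent (rows A)"
    using assms det_dependent_rows by (metis dependent_vec_eq)
  then show "independent ((\<lambda>i. row i A) ` X)"
    by (rule independent_mono) (auto simp: rows_def)
qed

lemma enumerated_basis_extension:
  fixes B :: "(real^'n) set"
  assumes "independent B"
  obtains h :: "'n \<Rightarrow> real^'n" where "inj h" "B \<subseteq> range h" "span (range h) = UNIV"
proof -
  obtain B' where B': "B \<subseteq> B'" "independent B'" "span B' = UNIV"
    using maximal_independent_subset_extend[OF subset_UNIV assms] by (metis top.extremum_uniqueI)
  have "card B' = CARD('n)"
    using dim_span_eq_card_independent[OF B'(2)] B'(3) by simp
  then have "\<exists>h. bij_betw h (UNIV :: 'n set) B'"
    using B'(2) by (intro finite_same_card_bij) (auto simp: independent_imp_finite)
  then obtain h where "bij_betw h (UNIV :: 'n set) B'" ..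
  then show ?thesis using that[of h] B' by (simp add: bij_betw_def)
qed

text \<open>Lower bounds on the dimension spanned by polynomially varying vectors are Zariski open:
  vectors independent at one point are completed to a basis, and the determinant of this
  basis is a polynomial in the parameters.\<close>

lemma generically_dim_ge:
  fixes v :: "'i \<Rightarrow> 'p::real_normed_vector \<Rightarrow> real^'n"
  assumes poly: "\<And>i j. i \<in> I \<Longrightarrow> real_polynomial_function (\<lambda>\<theta>. v i \<theta> $ j)"
    and c: "c \<le> dim ((\<lambda>i. v i \<theta>0) ` I)"
  shows "generically (\<lambda>\<theta>. c \<le> dim ((\<lambda>i. v i \<theta>) ` I))"
proof -
  obtain B where B: "B \<subseteq> (\<lambda>i. v i \<theta>0) ` I" "independent B" "card B = dim ((\<lambda>i. v i \<theta>0) ` I)"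
    using basis_exists by metis
  obtain h :: "'n \<Rightarrow> real^'n" where h: "inj h" "B \<subseteq> range h" "span (range h) = UNIV"
    by (rule enumerated_basis_extension[OF B(2)])
  have "\<forall>b\<in>B. \<exists>i\<in>I. b = v i \<theta>0" using B(1) by auto
  then obtain idx where idx: "\<And>b. b \<in> B \<Longrightarrow> idx b \<in> I \<and> v (idx b) \<theta>0 = b" by metis
  define D where "D \<theta> = (\<chi> j. if h j \<in> B then v (idx (h j)) \<theta> else h j)" for \<theta>
  have row_D: "row j (D \<theta>) = (if h j \<in> B then v (idx (h j)) \<theta> else h j)" for j \<theta>
    by (simp add: row_def D_def vec_eq_iff)
  have "real_polynomial_function (\<lambda>\<theta>. det (D \<theta>))"
  proof (rule real_polynomial_function_det)
    fix i j
    show "real_polynomial_function (\<lambda>\<theta>. D \<theta> $ i $ j)"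
      by (cases "h i \<in> B") (simp_all add: D_def poly idx real_polynomial_function.intros(2))
  qed
  moreover have "det (D \<theta>0) \<noteq> 0"
  proof -
    have "rows (D \<theta>0) = range h"
      using idx by (auto simp: rows_def row_D)
    then have "span (rows (D \<theta>0)) = UNIV" using h(3) by simp
    then show ?thesis
      using matrix_left_invertible_span_rows invertible_left_inverse invertible_det_nz by blast
  qed
  moreover have "c \<le> dim ((\<lambda>i. v i \<theta>) ` I)" if nz: "det (D \<theta>) \<noteq> 0" for \<theta>
  proof -
    have "card (h -` B) = card B"
      by (rule card_vimage_inj[OF h(1,2)])
    then have "c \<le> card (h -` B)" using c B(3) by simp
    also have "\<dots> = card ((\<lambda>j. row j (D \<theta>)) ` (h -` B))"
      using det_nonzero_imp_independent_rows(1)[OF nz] by (metis card_image inj_on_subset subset_UNIV)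
    also have "\<dots> = dim ((\<lambda>j. row j (D \<theta>)) ` (h -` B))"
      using det_nonzero_imp_independent_rows(2)[OF nz] by (metis dim_eq_card_independent)
    also have "\<dots> \<le> dim ((\<lambda>i. v i \<theta>) ` I)"
      by (rule dim_subset) (auto simp: row_D idx)
    finally show ?thesis .
  qed
  ultimately show ?thesis unfolding generically_def by blast
qed

section \<open>Principal minors and invariant subspaces\<close>

lemma matrix_add_rdistrib: "(A + B) ** C = A ** C + B ** (C :: real^'n^'n)"
  by (simp add: matrix_matrix_mult_def vec_eq_iff distrib_right sum.distrib)

text \<open>Multilinearity in the rows: each row of \<open>B + x N\<close> is taken either from \<open>B\<close> or from \<open>x N\<close>.\<close>

lemma det_add_smult_rows:
  fixes B N :: "real^'n^'n"
  shows "det (\<chi> i. B $ i + x *s N $ i) =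
    (\<Sum>W\<in>UNIV. x ^ card W * det (\<chi> i. if i \<in> W then N $ i else B $ i))"
proof -
  have "(\<Prod>i\<in>UNIV. B $ i $ p i + x * N $ i $ p i) =
      (\<Sum>W\<in>UNIV. x ^ card W * (\<Prod>i\<in>UNIV. (if i \<in> W then N $ i else B $ i) $ p i))" for p
  proof -
    have "(\<Prod>i\<in>UNIV. B $ i $ p i + x * N $ i $ p i) =
        (\<Sum>W\<in>Pow UNIV. (\<Prod>i\<in>W. x * N $ i $ p i) * (\<Prod>i\<in>UNIV - W. B $ i $ p i))"
      by (subst add.commute, rule prod_add) simp
    also have "\<dots> = (\<Sum>W\<in>UNIV. x ^ card W * (\<Prod>i\<in>UNIV. (if i \<in> W then N $ i else B $ i) $ p i))"
    proof (rule sum.cong)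
      fix W :: "'n set"
      have "(\<Prod>i\<in>UNIV. (if i \<in> W then N $ i else B $ i) $ p i) =
          (\<Prod>i\<in>UNIV. if i \<in> W then N $ i $ p i else B $ i $ p i)"
        by (intro prod.cong) auto
      also have "\<dots> = (\<Prod>i\<in>W. N $ i $ p i) * (\<Prod>i\<in>UNIV - W. B $ i $ p i)"
        by (subst prod.If_cases) (simp_all add: Compl_eq_Diff_UNIV)
      finally show "(\<Prod>i\<in>W. x * N $ i $ p i) * (\<Prod>i\<in>UNIV - W. B $ i $ p i) =
          x ^ card W * (\<Prod>i\<in>UNIV. (if i \<in> W then N $ i else B $ i) $ p i)"
        by (simp add: prod.distrib mult.assoc)
    qed simp
    finally show ?thesis .
  qed
  then show ?thesis
    unfolding det_def
    by (simp add: sum_distrib_left, subst sum.swap, simp add: mult.left_commute)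
qed

text \<open>The determinant of \<open>minor_matrix N W\<close> is the principal minor of \<open>N\<close> with index set \<open>W\<close>: rows
  outside \<open>W\<close> are replaced by those of the identity, so no submatrix type is needed.\<close>

definition minor_matrix :: "real^'n^'n \<Rightarrow> 'n set \<Rightarrow> real^'n^'n" where
  "minor_matrix N W = (\<chi> i. if i \<in> W then N $ i else mat 1 $ i)"

text \<open>The polynomial \<open>det (I + x N)\<close>, defined through its coefficients, the sums of the principal
  minors of a given size.\<close>

definition minor_poly :: "real^'n^'n \<Rightarrow> real poly" where
  "minor_poly N = (\<Sum>W\<in>UNIV. monom (det (minor_matrix N W)) (card W))"

lemma poly_minor_poly: "poly (minor_poly N) x = det (mat 1 + x *\<^sub>R N)"
proof -
  have "mat 1 + x *\<^sub>R N = (\<chi> i. mat 1 $ i + x *s N $ i)"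
    by (simp add: vec_eq_iff)
  then show ?thesis
    by (simp add: det_add_smult_rows minor_poly_def minor_matrix_def poly_sum poly_monom mult.commute)
qed

lemma coeff_minor_poly:
  "coeff (minor_poly N) r = (\<Sum>W | card W = r. det (minor_matrix N W))"
  by (simp add: minor_poly_def coeff_sum sum.If_cases)

lemma minor_poly_nonzero: "minor_poly N \<noteq> 0"
  using poly_minor_poly[of N 0] by force

text \<open>A linear change of coordinates turns any subspace into a coordinate subspace.\<close>

lemma subspace_coordinates:
  fixes R :: "(real^'n) set"
  assumes "subspace R"
  obtains P Pi :: "real^'n^'n" and W where "P ** Pi = mat 1" "Pi ** P = mat 1" "card W = dim R"
    "\<And>y. P *v y \<in> R \<longleftrightarrow> (\<forall>i. i \<notin> W \<longrightarrow> y $ i = 0)"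
proof -
  obtain B where B: "B \<subseteq> R" "independent B" "R \<subseteq> span B" "card B = dim R"
    using basis_exists by metis
  have span_B: "span B = R" using B assms by (metis span_minimal subset_antisym)
  obtain h :: "'n \<Rightarrow> real^'n" where h: "inj h" "B \<subseteq> range h" "span (range h) = UNIV"
    by (rule enumerated_basis_extension[OF B(2)])
  define P where "P = (\<chi> i j. h j $ i)"
  have col: "column j P = h j" for j by (simp add: P_def column_def vec_eq_iff)
  have "columns P = range h" by (auto simp: columns_def col)
  then have "span (columns P) = UNIV" using h(3) by simp
  then have "\<exists>Pi. P ** Pi = mat 1"
    using matrix_right_invertible_span_columns[of P] by (simp add: span_vec_eq)
  then obtain Pi where Pi: "P ** Pi = mat 1" ..
  then have Pi': "Pi ** P = mat 1" by (simp add: matrix_left_right_inverse)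
  define W where "W = h -` B"
  have card_W: "card W = dim R"
    unfolding W_def using card_vimage_inj[OF h(1,2)] B(4) by simp
  have Pv: "P *v y = (\<Sum>j\<in>UNIV. y $ j *\<^sub>R h j)" for y
    by (simp add: matrix_mult_sum col scalar_mult_eq_scaleR)
  let ?Y = "{y :: real^'n. \<forall>i. i \<notin> W \<longrightarrow> y $ i = 0}"
  have sub: "(*v) P ` ?Y \<subseteq> R"
  proof clarify
    fix y :: "real^'n" assume y: "\<forall>i. i \<notin> W \<longrightarrow> y $ i = 0"
    have "y $ j *\<^sub>R h j \<in> R" for j
    proof (cases "j \<in> W")
      case True
      then have "h j \<in> R" using B(1) by (auto simp: W_def)
      then show ?thesis by (simp add: assms subspace_scale)
    qed (use y in \<open>simp add: subspace_0 assms\<close>)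
    then show "P *v y \<in> R" unfolding Pv by (intro subspace_sum[OF assms])
  qed
  have inj: "inj ((*v) P)" using Pi' matrix_left_invertible_injective[of P] by auto
  have sY: "subspace ?Y" by (auto simp: subspace_def)
  have "dim ((*v) P ` ?Y) = dim ?Y"
    by (rule dim_image_eq) (auto intro: inj_on_subset[OF inj])
  also have "\<dots> = card W" using dim_substandard_cart[of W, where 'a = real] by (simp add: dim_vec_eq)
  finally have "dim R \<le> dim ((*v) P ` ?Y)" using card_W by simp
  moreover have "subspace ((*v) P ` ?Y)"
    using sY by (intro linear_subspace_image) auto
  ultimately have eq: "(*v) P ` ?Y = R"
    using sub assms by (intro subspace_dim_equal)
  have "P *v y \<in> R \<longleftrightarrow> y \<in> ?Y" for y
    using inj_image_mem_iff[OF inj, of y ?Y] unfolding eq .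
  then show ?thesis using that[of P Pi W] Pi Pi' card_W by simp
qed

text \<open>In coordinates adapted to \<open>R\<close> the matrix \<open>N\<close> is block triangular, and \<open>det (I + x N)\<close> is the
  product of a nonzero polynomial with the corresponding determinant of the block acting on \<open>R\<close>. The
  leading coefficient of the latter is the determinant of this block, which is invertible.\<close>

lemma degree_minor_poly_ge:
  fixes N :: "real^'n^'n"
  assumes R: "subspace R" and NR: "(*v) N ` R = R"
  shows "dim R \<le> degree (minor_poly N)"
proof -
  obtain P Pi :: "real^'n^'n" and W where P: "P ** Pi = mat 1" "Pi ** P = mat 1"
    and card_W: "card W = dim R"
    and P_mem: "\<And>y. P *v y \<in> R \<longleftrightarrow> (\<forall>i. i \<notin> W \<longrightarrow> y $ i = 0)"
    using subspace_coordinates[OF R] by blast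
  define C where "C = Pi ** N ** P"
  have P_C: "P *v (C *v y) = N *v (P *v y)" for y
    by (simp add: C_def matrix_vector_mul_assoc matrix_mul_assoc P)
  have C_zero: "C $ i $ j = 0" if "i \<notin> W" "j \<in> W" for i j
  proof -
    have "P *v axis j 1 \<in> R" unfolding P_mem using that by (auto simp: axis_def)
    then have "P *v (C *v axis j 1) \<in> R" using NR P_C by auto
    then have "(C *v axis j 1) $ i = 0" using P_mem that by blast
    then show ?thesis by (simp add: matrix_vector_mult_basis column_def)
  qed
  (* X is the diagonal block acting on R, and Y consists of the remaining columns of C. *)
  define X where "X = (\<chi> i j. if i \<in> W \<and> j \<in> W then C $ i $ j else 0)"
  define Y where "Y = (\<chi> i j. if j \<in> W then 0 else C $ i $ j)"
  have factor: "mat 1 + x *\<^sub>R C = (mat 1 + x *\<^sub>R Y) ** (mat 1 + x *\<^sub>R X)" for x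
  proof -
    have "Y $ i $ k * X $ k $ j = 0" for i j k by (simp add: X_def Y_def)
    then have "Y ** X = 0" by (simp only: matrix_matrix_mult_def vec_eq_iff) simp
    moreover have "C = X + Y" by (auto simp: X_def Y_def vec_eq_iff C_zero)
    ultimately show ?thesis
      by (simp add: matrix_add_ldistrib matrix_add_rdistrib matrix_scalar_ac
          scaleR_add_right flip: scalar_matrix_assoc)
  qed
  have det_conj: "det (mat 1 + x *\<^sub>R N) = det (mat 1 + x *\<^sub>R C)" for x
  proof -
    have "mat 1 + x *\<^sub>R C = Pi ** (mat 1 + x *\<^sub>R N) ** P"
      unfolding C_def
      by (simp add: matrix_add_ldistrib matrix_add_rdistrib P matrix_scalar_ac matrix_mul_assoc
          flip: scalar_matrix_assoc)
    then have "det (mat 1 + x *\<^sub>R C) = det (Pi ** P) * det (mat 1 + x *\<^sub>R N)"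
      by (simp add: det_mul)
    then show ?thesis by (simp add: P)
  qed
  have "minor_poly N = minor_poly Y * minor_poly X"
    unfolding poly_eq_poly_eq_iff[symmetric]
    by (rule ext) (simp add: poly_minor_poly det_conj factor det_mul)
  then have deg: "degree (minor_poly N) = degree (minor_poly Y) + degree (minor_poly X)"
    by (simp add: degree_mult_eq minor_poly_nonzero)
  have "coeff (minor_poly X) (card W) = det (minor_matrix X W)"
  proof -
    have "det (minor_matrix X V) = 0" if V: "card V = card W" "V \<noteq> W" for V
    proof -
      obtain i where i: "i \<in> V" "i \<notin> W"
        using V by (metis card_subset_eq finite subsetI)
      then have "row i (minor_matrix X V) = 0"
        by (simp add: minor_matrix_def X_def row_def vec_eq_iff)
      then show ?thesis by (rule det_zero_row(2))
    qed
    then show ?thesis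
      unfolding coeff_minor_poly
      by (subst sum.remove[of _ W]) (auto intro!: sum.neutral)
  qed
  moreover have "det (minor_matrix X W) \<noteq> 0"
  proof -
    (* On W the preimage comes from N mapping R onto R; off W the matrix is the identity. *)
    have "\<exists>z. minor_matrix X W *v z = t" for t
    proof -
      define tW where "tW = (\<chi> i. if i \<in> W then t $ i else 0)"
      have "P *v tW \<in> R" unfolding P_mem by (simp add: tW_def)
      then obtain x where x: "x \<in> R" "N *v x = P *v tW" using NR by (metis imageE)
      define y where "y = Pi *v x"
      have Py: "P *v y = x" by (simp add: y_def matrix_vector_mul_assoc P)
      then have y_zero: "y $ j = 0" if "j \<notin> W" for j using P_mem[of y] x(1) that by blast
      have "P *v (C *v y) = P *v tW" unfolding P_C Py by (rule x(2))
      then have Cy: "C *v y = tW" by (metis P(2) matrix_vector_mul_assoc matrix_vector_mul_lid)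
      have "(minor_matrix X W *v (y + (t - tW))) $ i = t $ i" for i
      proof (cases "i \<in> W")
        case True
        then have "(minor_matrix X W *v (y + (t - tW))) $ i = (C *v y) $ i"
          by (auto simp: matrix_vector_mult_def minor_matrix_def X_def tW_def y_zero intro!: sum.cong)
        then show ?thesis using Cy True by (simp add: tW_def)
      next
        case False
        then have "(minor_matrix X W *v (y + (t - tW))) $ i = (mat 1 *v (y + (t - tW))) $ i"
          by (simp add: matrix_vector_mult_def minor_matrix_def)
        then show ?thesis using False by (simp add: tW_def y_zero)
      qed
      then show ?thesis by (metis vec_eq_iff)
    qed
    then have "surj (\<lambda>y. minor_matrix X W *v y)" unfolding surj_def by metis
    then show ?thesis
      using matrix_right_invertible_surjective invertible_right_inverse invertible_det_nz by blast
  qed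
  ultimately have "card W \<le> degree (minor_poly X)" by (simp add: le_degree)
  with deg card_W show ?thesis by simp
qed

section \<open>The subspace reached by the inputs and the nonsingular dynamics\<close>

definition axis_vectors :: "'n set \<Rightarrow> (real^'n) set" where
  "axis_vectors S = (\<lambda>j. axis j 1) ` S"

lemma span_axis_vectors: "span (axis_vectors W) = {y :: real^'n. \<forall>i. i \<notin> W \<longrightarrow> y $ i = 0}" (is "_ = ?Y")
  and dim_axis_vectors: "dim (axis_vectors W :: (real^'n) set) = card W"
proof -
  have card: "dim ?Y = card W"
    using dim_substandard_cart[of W, where 'a = real] by (simp add: dim_vec_eq)
  have sub: "subspace ?Y" by (auto simp: subspace_def)
  have "axis_vectors W \<subseteq> ?Y" by (auto simp: axis_vectors_def axis_def)
  then have "span (axis_vectors W) \<subseteq> ?Y" using sub by (rule span_minimal)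
  moreover have "?Y \<subseteq> span (axis_vectors W)"
  proof
    fix y assume y: "y \<in> ?Y"
    have "(\<Sum>j\<in>UNIV. y $ j *\<^sub>R axis j 1) \<in> span (axis_vectors W)"
    proof (rule span_sum)
      fix j
      show "y $ j *\<^sub>R axis j 1 \<in> span (axis_vectors W)"
        using y by (cases "j \<in> W") (auto simp: axis_vectors_def intro: span_scale span_base span_zero)
    qed
    then show "y \<in> span (axis_vectors W)"
      using basis_expansion[of y] by (simp add: scalar_mult_eq_scaleR)
  qed
  ultimately show eq: "span (axis_vectors W) = ?Y" by blast
  show "dim (axis_vectors W :: (real^'n) set) = card W" using card by (metis eq dim_span)
qed

text \<open>The smallest subspace containing \<open>M X\<close> and the input directions \<open>e\<^sub>j\<close>, \<open>j \<in> S\<close>.\<close>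

definition controlled_image :: "real^'n^'n \<Rightarrow> 'n set \<Rightarrow> (real^'n) set \<Rightarrow> (real^'n) set" where
  "controlled_image M S X = span ((*v) M ` X \<union> axis_vectors S)"

text \<open>The largest subspace fixed by \<open>controlled_image M S\<close>, obtained by iteration from the whole
  space. A decreasing chain of subspaces of an \<open>n\<close>-dimensional space is stationary from step \<open>n\<close> on;
  one further iteration costs nothing and simplifies the counting. For \<open>S = {}\<close> this is the
  nonsingular part of the Fitting decomposition of \<open>M\<close>; for general \<open>S\<close> the controllable subspace
  is added.\<close>

definition fitting_space :: "real^'n^'n \<Rightarrow> 'n::finite set \<Rightarrow> (real^'n) set" where
  "fitting_space M S = (controlled_image M S ^^ Suc CARD('n)) UNIV"

lemma controlled_image_mono: "X \<subseteq> Y \<Longrightarrow> controlled_image M S X \<subseteq> controlled_image M S Y"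
  unfolding controlled_image_def by (intro span_mono) auto

lemma controlled_image_span: "controlled_image M S (span X) = span ((*v) M ` X \<union> axis_vectors S)"
proof -
  have "(*v) M ` span X = span ((*v) M ` X)"
    by (simp add: linear_span_image)
  moreover have "span (span Y \<union> Z) = span (Y \<union> Z)" for Y Z :: "(real^'a) set"
    by (simp only: span_Un span_span)
  ultimately show ?thesis by (simp add: controlled_image_def)
qed

lemma subspace_controlled_image_funpow: "subspace ((controlled_image M S ^^ l) UNIV)"
  by (cases l) (auto simp: controlled_image_def)

lemma subspace_fitting_space: "subspace (fitting_space M S)"
  unfolding fitting_space_def by (rule subspace_controlled_image_funpow)

lemma controlled_image_fitting_space: "controlled_image M S (fitting_space M S) = fitting_space (M :: real^'n^'n) S"
proof -
  let ?F = "\<lambda>l. (controlled_image M S ^^ l) UNIV"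
  have decr: "?F (Suc l) \<subseteq> ?F l" for l
  proof (induction l)
    case (Suc l)
    then show ?case using controlled_image_mono[of "?F (Suc l)" "?F l" M S] by simp
  qed simp
  have "?F (Suc l) = ?F l \<or> dim (?F l) + l \<le> CARD('n)" for l
  proof (induction l)
    case 0
    show ?case by simp
  next
    case (Suc l)
    show ?case
    proof (cases "?F (Suc l) = ?F l")
      case True
      then have "controlled_image M S (?F (Suc l)) = controlled_image M S (?F l)" by simp
      then show ?thesis by simp
    next
      case False
      then have "dim (?F (Suc l)) < dim (?F l)"
        using subspace_dim_equal[OF subspace_controlled_image_funpow subspace_controlled_image_funpow decr]
        by (meson not_le)
      then show ?thesis using Suc False by linarith
    qed
  qed
  from this[of "Suc CARD('n)"] show ?thesis by (simp add: fitting_space_def)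
qed

lemma subset_fitting_space: "X \<subseteq> controlled_image M S X \<Longrightarrow> X \<subseteq> fitting_space M S"
proof -
  assume X: "X \<subseteq> controlled_image M S X"
  have "X \<subseteq> (controlled_image M S ^^ l) UNIV" for l
  proof (induction l)
    case (Suc l)
    then show ?case using X controlled_image_mono[of X "(controlled_image M S ^^ l) UNIV" M S] by simp
  qed simp
  then show ?thesis unfolding fitting_space_def .
qed

text \<open>Generators of the \<open>L\<close>-th iterate: \<open>M\<^sup>L e\<^sub>i\<close> for all \<open>i\<close> (summand \<open>Inl\<close>), and \<open>M\<^sup>k e\<^sub>j\<close> for \<open>k < L\<close>
  and \<open>j \<in> S\<close> (summand \<open>Inr\<close>). The vectors do not depend on \<open>S\<close>, only the index set does.\<close>

fun krylov :: "real^'n^'n \<Rightarrow> nat \<Rightarrow> 'n + nat \<times> 'n \<Rightarrow> real^'n" where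
  "krylov M L (Inl i) = ((*v) M ^^ L) (axis i 1)"
| "krylov M L (Inr (k, j)) = ((*v) M ^^ k) (axis j 1)"

definition krylov_index :: "nat \<Rightarrow> 'n set \<Rightarrow> ('n + nat \<times> 'n) set" where
  "krylov_index L S = range Inl \<union> Inr ` ({..<L} \<times> S)"

lemma controlled_image_funpow: "(controlled_image M S ^^ L) UNIV = span (krylov M L ` krylov_index L S)"
proof (induction L)
  case 0
  have "krylov M 0 ` krylov_index 0 S = axis_vectors UNIV"
    by (simp add: krylov_index_def axis_vectors_def image_image)
  then show ?case by (simp add: span_axis_vectors)
next
  case (Suc L)
  have "(*v) M ` krylov M L ` Inr ` ({..<L} \<times> S) \<union> axis_vectors S
      = krylov M (Suc L) ` Inr ` ({..<Suc L} \<times> S)" (is "?l = ?r")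
  proof
    show "?l \<subseteq> ?r"
    proof
      fix x assume "x \<in> ?l"
      then consider k j where "k < L" "j \<in> S" "x = krylov M (Suc L) (Inr (Suc k, j))"
        | j where "j \<in> S" "x = krylov M (Suc L) (Inr (0, j))"
        by (auto simp: axis_vectors_def)
      then show "x \<in> ?r"
      proof cases
        case 1
        then have "(Suc k, j) \<in> {..<Suc L} \<times> S" by simp
        then show ?thesis unfolding 1(3) by blast
      next
        case 2
        then have "(0, j) \<in> {..<Suc L} \<times> S" by simp
        then show ?thesis unfolding 2(2) by blast
      qed
    qed
    show "?r \<subseteq> ?l"
    proof
      fix x assume "x \<in> ?r"
      then obtain k j where x: "k < Suc L" "j \<in> S" "x = krylov M (Suc L) (Inr (k, j))" by auto
      show "x \<in> ?l"
      proof (cases k)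
        case 0
        then have "x \<in> axis_vectors S" using x by (simp add: axis_vectors_def)
        then show ?thesis by blast
      next
        case (Suc k')
        then have eq: "x = M *v krylov M L (Inr (k', j))"
          unfolding x(3) by simp
        have "(k', j) \<in> {..<L} \<times> S"
          using x(1,2) Suc by simp
        then show ?thesis unfolding eq by (intro UnI1 imageI)
      qed
    qed
  qed
  moreover have "(*v) M ` krylov M L ` range Inl = krylov M (Suc L) ` range Inl"
    by (simp add: image_image)
  ultimately have "(*v) M ` krylov M L ` krylov_index L S \<union> axis_vectors S
      = krylov M (Suc L) ` krylov_index (Suc L) S"
    by (simp only: krylov_index_def image_Un Un_assoc)
  then show ?case using Suc by (simp add: controlled_image_span)
qed

lemma fitting_space_eq:
  "fitting_space (M :: real^'n^'n) S
    = span (krylov M (Suc CARD('n)) ` krylov_index (Suc CARD('n)) S)"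
  unfolding fitting_space_def by (rule controlled_image_funpow)

lemma fitting_space_mono: "S \<subseteq> T \<Longrightarrow> fitting_space M S \<subseteq> fitting_space M T"
  unfolding fitting_space_eq by (intro span_mono) (auto simp: krylov_index_def)

lemma dim_fitting_space_submodular:
  "submodular (\<lambda>S. real (dim (fitting_space (M :: real^'n^'n) S)))"
  unfolding submodular_def
proof (intro allI)
  fix S T :: "'n set"
  let ?R = "fitting_space M"
  have "krylov_index L (S \<union> T) = krylov_index L S \<union> krylov_index L T" for L
    by (auto simp: krylov_index_def)
  then have "?R (S \<union> T) = {x + y | x y. x \<in> ?R S \<and> y \<in> ?R T}"
    by (simp only: fitting_space_eq image_Un span_Un)
  then have "dim (?R (S \<union> T)) + dim (?R S \<inter> ?R T) = dim (?R S) + dim (?R T)"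
    by (simp add: dim_sums_Int subspace_fitting_space)
  moreover have "dim (?R (S \<inter> T)) \<le> dim (?R S \<inter> ?R T)"
    by (intro dim_subset) (simp add: fitting_space_mono)
  ultimately have "dim (?R (S \<union> T)) + dim (?R (S \<inter> T)) \<le> dim (?R S) + dim (?R T)" by linarith
  then show "real (dim (?R (S \<union> T))) + real (dim (?R (S \<inter> T))) \<le> real (dim (?R S)) + real (dim (?R T))"
    by (simp flip: of_nat_add)
qed

text \<open>Adding state feedback through the inputs in \<open>S\<close> changes only the rows of \<open>M\<close> in \<open>S\<close>. It makes
  the map from \<open>R\<close> to \<open>R\<close> bijective: the directions missing from \<open>M R\<close> are input directions, and the
  feedback sends to them the basis vectors of \<open>R\<close> not needed to generate \<open>M R\<close>.\<close>

lemma bijective_feedback: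
  fixes M :: "real^'n^'n"
  assumes R: "subspace R" and image: "controlled_image M S R = R"
  obtains N where "\<And>i. i \<notin> S \<Longrightarrow> N $ i = M $ i" "(*v) N ` R = R"
proof -
  let ?MR = "(*v) M ` R"
  have gen: "span (?MR \<union> axis_vectors S) = R" using image by (simp add: controlled_image_def)
  have MR_sub: "?MR \<subseteq> R" and axes_sub: "axis_vectors S \<subseteq> R"
    using span_superset[of "?MR \<union> axis_vectors S"] unfolding gen by auto
  have lin: "linear ((*v) M)" by simp
  obtain D where D: "D \<subseteq> ?MR" "independent D" "?MR \<subseteq> span D"
    using basis_exists by metis
  obtain D' where D': "D \<subseteq> D'" "D' \<subseteq> D \<union> axis_vectors S" "independent D'" "D \<union> axis_vectors S \<subseteq> span D'"
    by (rule maximal_independent_subset_extend[OF Un_upper1 D(2)])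
  have "?MR \<subseteq> span D'" using D(3) D'(1) span_mono by blast
  then have "R \<subseteq> span D'" using D'(4) gen by (metis le_sup_iff span_minimal subspace_span)
  moreover have D'_sub: "D' \<subseteq> R" using D'(2) D(1) MR_sub axes_sub by blast
  ultimately have span_D': "span D' = R" using R by (metis span_minimal subset_antisym)
  (* C consists of preimages of the basis D of M R. It is extended to a basis C' of R, and the new
     vectors are matched with the input directions in D' - D. *)
  obtain C where C: "C \<subseteq> R" "(*v) M ` C = D" "inj_on ((*v) M) C"
    using D(1) unfolding subset_image_inj by auto
  have "finite D" using D(2) by (rule independent_imp_finite)
  then have "finite ((*v) M ` C)" by (simp only: C(2))
  then have "finite C" using C(3) by (rule finite_imageD)
  have card_C: "card C = card D" using card_image[OF C(3)] by (simp only: C(2))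
  have "card C = dim C"
  proof (rule antisym)
    show "card C \<le> dim C"
      using dim_image_le[OF lin, of C] D(2) by (simp add: C(2) card_C dim_eq_card_independent)
    show "dim C \<le> card C" using \<open>finite C\<close> by (rule dim_le_card')
  qed
  then have "independent C"
    using card_eq_dim[of C C] \<open>finite C\<close> by (simp add: span_superset)
  then obtain C' where C': "C \<subseteq> C'" "C' \<subseteq> R" "independent C'" "R \<subseteq> span C'"
    using maximal_independent_subset_extend[OF C(1)] by metis
  have "card C' = dim R" by (rule basis_card_eq_dim[OF C'(2,4,3)])
  moreover have "card D' = dim R"
    using D'(3) span_D' dim_span_eq_card_independent by metis
  ultimately have "card (C' - C) = card (D' - D)"
    using C'(1,3) D'(1,3) card_C by (simp add: card_Diff_subset finite_subset independent_imp_finite)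
  then obtain h where h: "bij_betw h (C' - C) (D' - D)"
    using C'(3) D'(3) by (metis finite_Diff finite_same_card_bij independent_imp_finite)
  define f where "f c = (if c \<in> C then 0 else h c)" for c
  obtain g where g: "linear g" "\<And>c. c \<in> C' \<Longrightarrow> g c = f c" "range g = span (f ` C')"
    using linear_independent_extend_subspace[OF C'(3), of f] by auto
  have h_axes: "h c \<in> axis_vectors S" if "c \<in> C' - C" for c
    using bij_betwE[OF h] D'(2) that by blast
  have "f ` C' \<subseteq> span (axis_vectors S)"
    using h_axes by (auto simp: f_def span_zero intro: span_base)
  then have range_g: "range g \<subseteq> span (axis_vectors S)"
    unfolding g(3) by (simp add: span_minimal)
  define N where "N = M + matrix g"
  have Nv: "N *v x = M *v x + g x" for x
    by (simp add: N_def matrix_vector_mult_add_rdistrib matrix_works g(1))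
  have "N $ i = M $ i" if "i \<notin> S" for i
  proof -
    have "g (axis j 1) $ i = 0" for j
      using range_g that unfolding span_axis_vectors by auto
    then show ?thesis by (simp add: N_def vec_eq_iff matrix_def)
  qed
  moreover have "(*v) N ` R = R"
  proof
    have "span (axis_vectors S) \<subseteq> R" using axes_sub R by (rule span_minimal)
    then have "g x \<in> R" for x using range_g by blast
    then show "(*v) N ` R \<subseteq> R"
      using MR_sub by (auto simp: Nv intro!: subspace_add[OF R])
    have sub: "subspace ((*v) N ` R)" using R by (intro linear_subspace_image) auto
    have D_img: "D \<subseteq> (*v) N ` R"
    proof
      fix d assume "d \<in> D"
      then obtain c where c: "c \<in> C" "d = M *v c" using C(2) by blast
      then have "N *v c = d" using g(2)[of c] C'(1) by (auto simp: Nv f_def)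
      then show "d \<in> (*v) N ` R" using c(1) C(1) by blast
    qed
    have MR_img: "?MR \<subseteq> (*v) N ` R"
      using D(3) span_minimal[OF D_img sub] by blast
    have "d \<in> (*v) N ` R" if "d \<in> D' - D" for d
    proof -
      obtain c where c: "c \<in> C' - C" "d = h c" using h \<open>d \<in> D' - D\<close> by (metis bij_betw_iff_bijections)
      then have "N *v c - M *v c = d" using g(2)[of c] by (auto simp: Nv f_def)
      moreover have "N *v c \<in> (*v) N ` R" "M *v c \<in> (*v) N ` R" using c(1) C'(2) MR_img by blast+
      ultimately show ?thesis using subspace_diff[OF sub] by metis
    qed
    then have "D' \<subseteq> (*v) N ` R" using D_img by blast
    then show "R \<subseteq> (*v) N ` R" using span_minimal[OF _ sub] span_D' by metis
  qed
  ultimately show ?thesis by (rule that)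
qed

section \<open>The first index\<close>

text \<open>The product of the diagonal matrix with diagonal \<open>d\<close> and \<open>A\<close>.\<close>

definition scale_rows :: "real^'n \<Rightarrow> real^'n^'n \<Rightarrow> real^'n^'n" where
  "scale_rows d A = (\<chi> i j. d $ i * A $ i $ j)"

lemma column_joint_submatrix:
  "column (Inl j) (joint_submatrix V A B) = (\<chi> i. if i \<in> V \<and> j \<in> V then A $ i $ j else 0)"
  "column (Inr j) (joint_submatrix V A B) = (\<chi> i. if i \<in> V \<and> j \<in> V then B $ i $ j else 0)"
  by (simp_all add: column_def joint_submatrix_def)

lemma columns_joint_submatrix: "columns (joint_submatrix V A B) \<subseteq> span (axis_vectors V)"
proof -
  have "column c (joint_submatrix V A B) \<in> span (axis_vectors V)" for c
    by (cases c) (simp_all add: column_joint_submatrix span_axis_vectors)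
  then show ?thesis by (auto simp: columns_def)
qed

lemma rank_joint_submatrix_le: "rank (joint_submatrix V A B) \<le> card V"
  unfolding column_rank_def dim_axis_vectors[symmetric]
  using columns_joint_submatrix by (rule dim_mono)

text \<open>The index set \<open>W\<close> of a nonzero principal minor of \<open>N\<close> has full rank in \<open>(A(W) | B(W))\<close>: otherwise
  some nonzero \<open>y\<close> supported on \<open>W\<close> is orthogonal to all columns. Then \<open>y\<close> vanishes on \<open>S\<close> because of
  the columns of \<open>B\<close>, and it yields a linear dependence between the rows of \<open>minor_matrix N W\<close>.\<close>

lemma dim_fitting_space_le_rank:
  fixes A :: "real^'n^'n"
  obtains W where "dim (fitting_space (scale_rows d A) S) \<le> card W"
    "card W \<le> rank (joint_submatrix W A (input_matrix S (\<chi> i. 1)))"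
proof -
  let ?M = "scale_rows d A"
  obtain N where N: "\<And>i. i \<notin> S \<Longrightarrow> N $ i = ?M $ i"
    "(*v) N ` fitting_space ?M S = fitting_space ?M S"
    using bijective_feedback[OF subspace_fitting_space controlled_image_fitting_space] by metis
  let ?r = "degree (minor_poly N)"
  have deg: "dim (fitting_space ?M S) \<le> ?r"
    by (rule degree_minor_poly_ge[OF subspace_fitting_space N(2)])
  have "coeff (minor_poly N) ?r \<noteq> 0" by (simp add: minor_poly_nonzero)
  then obtain W where W: "card W = ?r" "det (minor_matrix N W) \<noteq> 0"
    unfolding coeff_minor_poly by (metis (mono_tags, lifting) mem_Collect_eq sum.neutral)
  let ?J = "joint_submatrix W A (input_matrix S (\<chi> i. 1))"
  let ?K = "minor_matrix N W"
  have "card W \<le> rank ?J"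
  proof (rule ccontr)
    assume "\<not> card W \<le> rank ?J"
    then have "dim (columns ?J) < dim (axis_vectors W :: (real^'n) set)"
      by (simp add: column_rank_def dim_axis_vectors)
    then have "span (columns ?J) \<noteq> span (axis_vectors W)" by (metis dim_span less_irrefl)
    moreover have "span (columns ?J) \<subseteq> span (axis_vectors W)"
      by (intro span_minimal columns_joint_submatrix subspace_span)
    ultimately have "span (columns ?J) \<subset> span (axis_vectors W)" by blast
    then obtain y where y: "y \<noteq> 0" "y \<in> span (axis_vectors W)" "\<And>x. x \<in> span (columns ?J) \<Longrightarrow> orthogonal y x"
      using orthogonal_to_subspace_exists_gen[of "columns ?J" "axis_vectors W"] by metis
    have y_off: "y $ i = 0" if "i \<notin> W" for i using y(2) that by (simp add: span_axis_vectors)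
    have y_col: "y \<bullet> column c ?J = 0" for c
      using y(3)[of "column c ?J"] by (auto simp: orthogonal_def columns_def intro: span_base)
    have y_S: "y $ j = 0" if "j \<in> S" for j
    proof (cases "j \<in> W")
      case True
      then have "column (Inr j) ?J = axis j 1"
        using that by (auto simp: column_joint_submatrix input_matrix_def axis_def vec_eq_iff)
      then show ?thesis using y_col[of "Inr j"] by (simp add: inner_axis)
    qed (rule y_off)
    have y_A: "(\<Sum>i\<in>UNIV. y $ i * A $ i $ j) = 0" if "j \<in> W" for j
    proof -
      have "(\<Sum>i\<in>UNIV. y $ i * A $ i $ j) = y \<bullet> column (Inl j) ?J"
        unfolding inner_vec_def column_joint_submatrix using that y_off
        by (intro sum.cong) auto
      then show ?thesis using y_col by simp
    qed
    (* Undo the row scaling by d, which does not vanish on the support of y. *)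
    define z where "z = (\<chi> i. y $ i / d $ i)"
    have d_nz: "d $ i \<noteq> 0" if "y $ i \<noteq> 0" for i
    proof
      assume "d $ i = 0"
      moreover have "i \<in> W" "i \<notin> S" using that y_off y_S by blast+
      ultimately have "row i ?K = 0"
        by (simp add: row_def minor_matrix_def N(1) scale_rows_def vec_eq_iff)
      then show False using W(2) det_zero_row(2) by blast
    qed
    have zN: "z $ i * N $ i $ j = y $ i * A $ i $ j" for i j
    proof (cases "y $ i = 0")
      case False
      then have "i \<notin> S" using y_S by blast
      then show ?thesis using d_nz[OF False] by (simp add: z_def N(1) scale_rows_def)
    qed (simp add: z_def)
    define v where "v = z v* N"
    have v_W: "v $ j = 0" if "j \<in> W" for j
      using y_A[OF that] by (simp add: v_def vector_matrix_mult_def zN mult.commute[of "N $ _ $ _"])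
    (* Subtracting v, which vanishes on W, cancels the entries outside W against the identity rows. *)
    define z' where "z' = z - v"
    have "(z' v* ?K) $ j = 0" for j
    proof -
      have "(z' v* ?K) $ j = (\<Sum>i\<in>UNIV. z $ i * N $ i $ j - v $ i * mat 1 $ i $ j)"
        unfolding vector_matrix_mult_def
        using v_W y_off by (auto intro!: sum.cong simp: minor_matrix_def z'_def z_def)
      also have "\<dots> = (z v* N) $ j - (v v* mat 1) $ j"
        by (simp add: vector_matrix_mult_def sum_subtractf mult.commute)
      also have "\<dots> = 0" by (simp add: v_def)
      finally show ?thesis .
    qed
    then have zK: "z' v* ?K = 0" by (simp add: vec_eq_iff)
    obtain Ki where "?K ** Ki = mat 1"
      using W(2) invertible_det_nz invertible_right_inverse by metis
    then have "z' = (z' v* ?K) v* Ki" by (simp add: vector_matrix_mul_assoc)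
    then have "z' = 0" by (simp add: zK)
    have "y $ i = 0" for i
    proof (rule ccontr)
      assume nz: "y $ i \<noteq> 0"
      then have "v $ i = 0" using y_off v_W by blast
      then have "z $ i = 0" using \<open>z' = 0\<close> by (simp add: z'_def)
      then show False using nz d_nz[OF nz] by (simp add: z_def)
    qed
    then show False using y(1) by (simp add: vec_eq_iff)
  qed
  then show ?thesis using that[of W] deg W(1) by simp
qed

lemma card_le_dim_fitting_space:
  fixes A :: "real^'n^'n"
  assumes rank: "rank (joint_submatrix V A (input_matrix S \<beta>)) = card V"
  obtains d where "card V \<le> dim (fitting_space (scale_rows d A) S)"
proof -
  let ?J = "joint_submatrix V A (input_matrix S \<beta>)"
  define W where "W = V \<union> S"
  define d :: "real^'n" where "d = (\<chi> i. if i \<in> W then 1 else 0)"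
  let ?M = "scale_rows d A"
  let ?X = "span (axis_vectors W) :: (real^'n) set"
  have "span (columns ?J) = span (axis_vectors V)"
    by (rule subspace_dim_equal)
      (use rank in \<open>simp_all add: dim_axis_vectors column_rank_def span_minimal columns_joint_submatrix\<close>)
  then have axes_V: "axis_vectors V \<subseteq> span (columns ?J)" by (simp add: span_superset)
  have axes_S: "span (axis_vectors S) \<subseteq> controlled_image ?M S ?X"
    unfolding controlled_image_def by (intro span_mono) auto
  have "column c ?J \<in> controlled_image ?M S ?X" for c
  proof (cases c)
    case (Inl j)
    show ?thesis
    proof (cases "j \<in> V")
      case True
      have "axis j 1 \<in> ?X" using True by (auto simp: axis_vectors_def W_def intro: span_base)
      then have "?M *v axis j 1 \<in> controlled_image ?M S ?X"
        unfolding controlled_image_def by (intro span_base) auto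
      moreover have "?M *v axis j 1 - column c ?J \<in> span (axis_vectors S)"
        unfolding span_axis_vectors matrix_vector_mult_basis Inl column_joint_submatrix
        using True by (auto simp: column_def scale_rows_def d_def W_def)
      ultimately have "?M *v axis j 1 - (?M *v axis j 1 - column c ?J) \<in> controlled_image ?M S ?X"
        using axes_S unfolding controlled_image_def by (blast intro: span_diff)
      then show ?thesis by simp
    next
      case False
      then have "column c ?J = 0" by (simp add: Inl column_joint_submatrix vec_eq_iff)
      then show ?thesis by (simp add: controlled_image_def span_zero)
    qed
  next
    case (Inr j)
    have "column c ?J \<in> span (axis_vectors S)"
      unfolding span_axis_vectors by (auto simp: Inr column_joint_submatrix input_matrix_def)
    then show ?thesis using axes_S by blast
  qed
  then have "span (columns ?J) \<subseteq> controlled_image ?M S ?X"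
    by (intro span_minimal) (auto simp: columns_def controlled_image_def)
  then have "axis_vectors W \<subseteq> controlled_image ?M S ?X"
    using axes_V axes_S span_superset[of "axis_vectors S"] unfolding W_def axis_vectors_def by blast
  then have "?X \<subseteq> controlled_image ?M S ?X"
    by (intro span_minimal) (auto simp: controlled_image_def)
  then have "?X \<subseteq> fitting_space ?M S" by (rule subset_fitting_space)
  then have "dim ?X \<le> dim (fitting_space ?M S)" by (rule dim_subset)
  moreover have "card V \<le> card W" by (auto simp: W_def intro: card_mono)
  ultimately show ?thesis using that[of d] by (simp add: dim_axis_vectors)
qed

lemma real_polynomial_function_structured:
  assumes "\<And>i j. real_polynomial_function (\<lambda>p. \<theta> p $ i $ j)"
  shows "real_polynomial_function (\<lambda>p. (Q + structured P (\<theta> p)) $ i $ j)"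
  by (cases "(i, j) \<in> P")
     (auto simp: structured_def intro: real_polynomial_function.intros assms)

lemma real_polynomial_function_fst_nth:
  "real_polynomial_function (\<lambda>p :: (real^'n^'n) \<times> 'b::real_normed_vector. fst p $ i $ j)"
  by (intro real_polynomial_function.intros(1) bounded_linear_compose[OF bounded_linear_vec_nth]
      bounded_linear_fst)

lemma real_polynomial_function_snd_nth:
  "real_polynomial_function (\<lambda>p :: 'b::real_normed_vector \<times> (real^'n). snd p $ i)"
  by (intro real_polynomial_function.intros(1) bounded_linear_compose[OF bounded_linear_vec_nth]
      bounded_linear_snd)

lemma real_polynomial_function_krylov:
  fixes M :: "'p::real_normed_vector \<Rightarrow> real^'n^'n"
  assumes M: "\<And>i j. real_polynomial_function (\<lambda>p. M p $ i $ j)"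
  shows "real_polynomial_function (\<lambda>p. krylov (M p) L a $ i)"
proof -
  have "real_polynomial_function (\<lambda>p. ((*v) (M p) ^^ k) (axis j 1) $ i)" for k i j
  proof (induction k arbitrary: i)
    case (Suc k)
    have "((*v) (M p) ^^ Suc k) (axis j 1) $ i =
        (\<Sum>l\<in>UNIV. M p $ i $ l * ((*v) (M p) ^^ k) (axis j 1) $ l)" for p
      by (simp add: matrix_vector_mult_def)
    then show ?case
      by (simp only:) (intro real_polynomial_function_sum real_polynomial_function.intros(4) M Suc finite)
  qed (simp add: real_polynomial_function.intros(2))
  then show ?thesis by (cases a) (auto simp del: funpow.simps)
qed

text \<open>The sets over which the first index is maximized.\<close>

definition c1_feasible :: "real^'n^'n \<Rightarrow> ('n::finite \<times> 'n) set \<Rightarrow> 'n set \<Rightarrow> 'n set \<Rightarrow> bool" where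
  "c1_feasible QA PA S V \<longleftrightarrow> generically (\<lambda>(\<theta> :: real^'n^'n, \<beta> :: real^'n).
     rank (joint_submatrix V (QA + structured PA \<theta>) (input_matrix S \<beta>)) = card V)"

text \<open>Generic feasibility follows from full rank at a single parameter value.\<close>

lemma c1_feasibleI:
  fixes QA :: "real^'n^'n"
  assumes "card V \<le> rank (joint_submatrix V (QA + structured PA \<theta>) (input_matrix S \<beta>))"
  shows "c1_feasible QA PA S V"
proof -
  define J where "J p = joint_submatrix V (QA + structured PA (fst p)) (input_matrix S (snd p))"
    for p :: "(real^'n^'n) \<times> (real^'n)"
  have cols: "dim ((\<lambda>c. column c (J p)) ` UNIV) = rank (J p)" for p
    by (simp add: column_rank_def columns_def full_SetCompr_eq)
  have "generically (\<lambda>p. card V \<le> dim ((\<lambda>c. column c (J p)) ` UNIV))"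
  proof (rule generically_dim_ge)
    fix c i
    have "real_polynomial_function (\<lambda>p :: (real^'n^'n) \<times> (real^'n). input_matrix S (snd p) $ i $ j)" for j
    proof (cases "i = j \<and> i \<in> S")
      case True
      then have "input_matrix S \<beta> $ i $ j = \<beta> $ i" for \<beta> by (auto simp: input_matrix_def)
      then show ?thesis by (simp add: real_polynomial_function_snd_nth)
    next
      case False
      then have "input_matrix S \<beta> $ i $ j = 0" for \<beta> by (auto simp: input_matrix_def)
      then show ?thesis by (simp add: real_polynomial_function.intros(2))
    qed
    moreover have "real_polynomial_function
        (\<lambda>p :: (real^'n^'n) \<times> (real^'n). (QA + structured PA (fst p)) $ i $ j)" for j
      by (rule real_polynomial_function_structured[OF real_polynomial_function_fst_nth])
    moreover note real_polynomial_function.intros(2)[of 0]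
    ultimately show "real_polynomial_function (\<lambda>p. column c (J p) $ i)"
      unfolding J_def
      by (cases c; cases "i \<in> V"; cases "projl c \<in> V"; cases "projr c \<in> V")
         (simp_all add: column_joint_submatrix)
  next
    show "card V \<le> dim ((\<lambda>c. column c (J (\<theta>, \<beta>))) ` UNIV)"
      unfolding cols using assms by (simp add: J_def)
  qed
  then have "generically (\<lambda>p. card V \<le> rank (J p))"
    unfolding cols .
  then have "generically (\<lambda>p. rank (J p) = card V)"
    by (rule generically_mono) (simp add: J_def le_antisym rank_joint_submatrix_le)
  then show ?thesis by (simp add: c1_feasible_def J_def case_prod_unfold)
qed

lemma c1_eq_Max: "c1 QA PA S = Max (card ` {V. c1_feasible QA PA S V})"
  unfolding c1_def c1_feasible_def by (rule arg_cong[of _ _ Max]) auto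

lemma c1_feasible_le: "c1_feasible QA PA S V \<Longrightarrow> card V \<le> c1 QA PA S"
  unfolding c1_eq_Max by (intro Max_ge) auto

lemma c1_attained:
  obtains V where "c1_feasible QA PA S V" "card V = c1 QA PA S"
proof -
  have "c1_feasible QA PA S {}" by (rule c1_feasibleI) simp
  then have "Max (card ` {V. c1_feasible QA PA S V}) \<in> card ` {V. c1_feasible QA PA S V}"
    by (intro Max_in) auto
  then show ?thesis using that unfolding c1_eq_Max[symmetric] by auto
qed

text \<open>The matrix \<open>M\<close> does not depend on \<open>S\<close>, which is what makes the first index submodular.\<close>

theorem c1_eq_dim:
  fixes QA :: "real^'n^'n"
  shows "\<exists>M. \<forall>S. c1 QA PA S = dim (fitting_space M S)"
proof -
  define M where "M p = scale_rows (snd p) (QA + structured PA (fst p))"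
    for p :: "(real^'n^'n) \<times> (real^'n)"
  have M_poly: "real_polynomial_function (\<lambda>p. M p $ i $ j)" for i j
    unfolding M_def scale_rows_def
    by (simp, intro real_polynomial_function.intros(4) real_polynomial_function_snd_nth
        real_polynomial_function_structured[unfolded vector_add_component]
        real_polynomial_function_fst_nth)
  have "generically (\<lambda>p. c1 QA PA S \<le> dim (fitting_space (M p) S))" for S
  proof -
    obtain V where V: "c1_feasible QA PA S V" "card V = c1 QA PA S" by (rule c1_attained)
    obtain \<theta> \<beta> where "rank (joint_submatrix V (QA + structured PA \<theta>) (input_matrix S \<beta>)) = card V"
      using generically_ex[OF V(1)[unfolded c1_feasible_def]] by auto
    then obtain d where "card V \<le> dim (fitting_space (scale_rows d (QA + structured PA \<theta>)) S)"
      by (rule card_le_dim_fitting_space)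
    then have "c1 QA PA S \<le> dim (fitting_space (M (\<theta>, d)) S)" by (simp add: V(2) M_def)
    then show ?thesis
      unfolding fitting_space_eq dim_span
      by (intro generically_dim_ge real_polynomial_function_krylov M_poly)
  qed
  then have "generically (\<lambda>p. \<forall>S\<in>UNIV. c1 QA PA S \<le> dim (fitting_space (M p) S))"
    by (intro generically_finite_Ball) auto
  from generically_ex[OF this] obtain p where
    "\<forall>S\<in>UNIV. c1 QA PA S \<le> dim (fitting_space (M p) S)" ..
  then have p: "c1 QA PA S \<le> dim (fitting_space (M p) S)" for S by simp
  have "dim (fitting_space (M p) S) \<le> c1 QA PA S" for S
  proof -
    obtain W where W: "dim (fitting_space (M p) S) \<le> card W"
      "card W \<le> rank (joint_submatrix W (QA + structured PA (fst p)) (input_matrix S (\<chi> i. 1)))"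
      unfolding M_def by (rule dim_fitting_space_le_rank)
    have "card W \<le> c1 QA PA S" by (intro c1_feasible_le c1_feasibleI[OF W(2)])
    with W(1) show ?thesis by simp
  qed
  with p show ?thesis by (intro exI[of _ "M p"] allI le_antisym)
qed

section \<open>The second index\<close>

lemma card_UN_mono:
  fixes C :: "'n \<Rightarrow> 'n::finite set"
  shows "mono (\<lambda>S. real (card (\<Union>j\<in>S. C j)))"
  by (intro monoI of_nat_mono card_mono) auto

lemma card_UN_submodular:
  fixes C :: "'n \<Rightarrow> 'a::finite set"
  shows "submodular (\<lambda>S. real (card (\<Union>j\<in>S. C j)))"
  unfolding submodular_def
proof (intro allI)
  fix X Y
  let ?U = "\<lambda>S. \<Union>j\<in>S. C j"
  have "card (?U (X \<union> Y)) + card (?U (X \<inter> Y)) \<le> card (?U X \<union> ?U Y) + card (?U X \<inter> ?U Y)"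
    by (intro add_mono card_mono) auto
  also have "\<dots> = card (?U X) + card (?U Y)"
    by (simp add: card_Un_Int[of "?U X" "?U Y"])
  finally show "real (card (?U (X \<union> Y))) + real (card (?U (X \<inter> Y)))
      \<le> real (card (?U X)) + real (card (?U Y))"
    by (simp flip: of_nat_add)
qed

lemma Ghat_reach_input:
  assumes "j \<in> S"
  shows "(WT i, UQ j) \<in> (Ghat_edges QF QA T m S)\<^sup>* \<longleftrightarrow> (WT i, WT j) \<in> (G'_edges QF QA T m)\<^sup>*"
    (is "_ \<in> ?H\<^sup>* \<longleftrightarrow> _ \<in> ?G\<^sup>*")
proof
  have no_U: "x \<notin> range UT \<union> range UQ \<and> y \<notin> range UT \<union> range UQ" if "(x, y) \<in> ?G" for x y
  proof -
    have Q: "Q_vertex a \<noteq> UT l" "Q_vertex a \<noteq> UQ l" for a :: "'a + 'a" and l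
      by (cases a; simp)+
    show ?thesis using that by (auto simp: G'_edges_def Q Q[symmetric])
  qed
  assume "(WT i, UQ j) \<in> ?H\<^sup>*"
  (* A path from w_i^T that has arrived at u_l^T or u_l^Q has passed through w_l^T. *)
  moreover have "(case y of UT l \<Rightarrow> (WT i, WT l) \<in> ?G\<^sup>* | UQ l \<Rightarrow> (WT i, WT l) \<in> ?G\<^sup>* | _ \<Rightarrow> (WT i, y) \<in> ?G\<^sup>*)"
    if "(WT i, y) \<in> ?H\<^sup>*" for y
    using that
  proof (induction rule: rtrancl_induct)
    case (step y z)
    from step(2) consider "(y, z) \<in> ?G" | l where "y = WT l" "z = UT l" | l where "y = UT l" "z = UQ l"
      unfolding Ghat_edges_def by blast
    then show ?case
    proof cases
      case 1
      then show ?thesis using no_U[OF 1] step(3)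
        by (auto split: vertex.splits intro: rtrancl_into_rtrancl)
    qed (use step(3) in auto)
  qed simp
  ultimately show "(WT i, WT j) \<in> ?G\<^sup>*" by fastforce
next
  assume "(WT i, WT j) \<in> ?G\<^sup>*"
  then have "(WT i, WT j) \<in> ?H\<^sup>*"
    by (rule rtrancl_mono[THEN subsetD, rotated]) (auto simp: Ghat_edges_def)
  moreover have "(WT j, UT j) \<in> ?H" "(UT j, UQ j) \<in> ?H"
    using assms by (auto simp: Ghat_edges_def)
  ultimately show "(WT i, UQ j) \<in> ?H\<^sup>*" by (meson rtrancl_into_rtrancl)
qed

lemma c2_eq: "c2 QF QA T m S = card (\<Union>j\<in>S. {i. (WT i, WT j) \<in> (G'_edges QF QA T m)\<^sup>*})"
  unfolding c2_def by (rule arg_cong[of _ _ card]) (auto simp: Ghat_reach_input)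

section \<open>Greedy maximization\<close>

text \<open>If no single element raises the value at \<open>S\<close> above \<open>c\<close>, then each element of \<open>X\<close> contributes
  at most \<open>c - g S\<close>.\<close>

lemma mono_submodular_marginals:
  fixes g :: "'n::finite set \<Rightarrow> real"
  assumes mono: "mono g" and sub: "submodular g" and step: "\<And>w. g (insert w S) \<le> c"
  shows "g X \<le> g S + real (card X) * (c - g S)"
proof -
  have "g (S \<union> X) \<le> g S + real (card X) * (c - g S)"
    using finite[of X]
  proof (induction X rule: finite_induct)
    case (insert x X)
    have "g (S \<union> X \<union> insert x S) + g ((S \<union> X) \<inter> insert x S) \<le> g (S \<union> X) + g (insert x S)"
      using sub unfolding submodular_def by blast
    moreover have "S \<union> X \<union> insert x S = S \<union> insert x X" by blast
    moreover have "g S \<le> g ((S \<union> X) \<inter> insert x S)"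
      by (rule monoD[OF mono]) blast
    ultimately have "g (S \<union> insert x X) \<le> g (S \<union> X) + (c - g S)"
      using step[of x] by simp
    then show ?case using insert by (simp add: algebra_simps)
  qed simp
  then show ?thesis using monoD[OF mono, of X "S \<union> X"] by simp
qed

theorem greedy_approximation:
  fixes g :: "'n::finite set \<Rightarrow> real"
  assumes nonneg: "\<And>X. 0 \<le> g X" and mono: "mono g" and sub: "submodular g"
    and k: "0 < k" and opt: "card X \<le> k" and greedy: "greedy g k S"
  shows "(1 - 1 / exp 1) * g X \<le> g S"
proof -
  (* Each step multiplies the gap to g X by at most 1 - 1/k. *)
  have gap: "g X - g S \<le> (1 - 1 / real k) ^ l * g X" if "greedy g l S" for l S
    using that
  proof (induction rule: greedy.induct)
    case greedy_0
    show ?case using nonneg by simp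
  next
    case (greedy_Suc l S v)
    have "g X \<le> g S + real (card X) * (g (insert v S) - g S)"
      using greedy_Suc.hyps(2) by (rule mono_submodular_marginals[OF mono sub])
    also have "real (card X) * (g (insert v S) - g S) \<le> real k * (g (insert v S) - g S)"
      using opt monoD[OF mono, of S "insert v S"] by (intro mult_right_mono) auto
    finally have "(g X - g S) / real k \<le> g (insert v S) - g S"
      using k by (simp add: pos_divide_le_eq mult.commute)
    moreover have "(1 - 1 / real k) * (g X - g S) = (g X - g S) - (g X - g S) / real k"
      by (simp add: left_diff_distrib)
    ultimately have "g X - g (insert v S) \<le> (1 - 1 / real k) * (g X - g S)"
      by linarith
    also have "\<dots> \<le> (1 - 1 / real k) * ((1 - 1 / real k) ^ l * g X)"
      using greedy_Suc.IH k by (intro mult_left_mono) auto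
    finally show ?case by simp
  qed
  have "(1 - 1 / real k) ^ k \<le> exp (- 1)"
    using k by (intro exp_ge_one_minus_x_over_n_power_n) auto
  then have "(1 - 1 / real k) ^ k * g X \<le> exp (- 1) * g X"
    using nonneg by (intro mult_right_mono)
  then have "g X - g S \<le> exp (- 1) * g X"
    using gap[OF greedy] by linarith
  then show ?thesis
    by (simp add: exp_minus inverse_eq_divide left_diff_distrib)
qed

section \<open>The combined objective\<close>

lemma submodular_add:
  assumes "submodular f" "submodular g"
  shows "submodular (\<lambda>X. f X + g X)"
  unfolding submodular_def
proof (intro allI)
  fix X Y
  show "f (X \<union> Y) + g (X \<union> Y) + (f (X \<inter> Y) + g (X \<inter> Y)) \<le> f X + g X + (f Y + g Y)"
    using assms[unfolded submodular_def, rule_format, of X Y] by linarith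
qed

lemma submodular_mult: "0 \<le> c \<Longrightarrow> submodular f \<Longrightarrow> submodular (\<lambda>X. c * f X)"
  unfolding submodular_def by (simp add: mult_left_mono flip: distrib_left)

theorem theorem3p15:
  fixes QF QA :: "real^'n^'n::finite"
    and PF PA :: "('n \<times> 'n) set"
    and m :: "'n \<Rightarrow> 'n + 'n"
    and f :: "'n set \<Rightarrow> real"
    and \<eta> :: real
    and k :: nat
    and S Sopt :: "'n set"
  defines "obj \<equiv> (\<lambda>X. f X + \<eta> * (real (c1 QA PA X) + real (c2 QF QA (PA \<union> PF) m X)))"
  assumes "solvable QF PF QA PA"
    and "admissible_matching QF QA (PA \<union> PF) m"
    and "\<And>X. f X \<ge> 0"
    and "mono f"
    and "submodular f"
    and "\<eta> \<ge> 0"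
    and "k > 0"
    and "optimal_solution obj k Sopt"
    and "greedy obj k S"
  shows "obj S \<ge> (1 - 1 / exp 1) * obj Sopt"
proof -
  define C where "C j = {i. (WT i, WT j) \<in> (G'_edges QF QA (PA \<union> PF) m)\<^sup>*}" for j
  obtain M where "\<forall>X. c1 QA PA X = dim (fitting_space M X)"
    using c1_eq_dim[of QA PA] ..
  then have c1: "c1 QA PA X = dim (fitting_space M X)" for X by simp
  have c2: "c2 QF QA (PA \<union> PF) m X = card (\<Union>j\<in>X. C j)" for X
    by (simp add: c2_eq C_def)
  show ?thesis
  proof (rule greedy_approximation)
    show "0 \<le> obj X" for X using assms(4,7) by (simp add: obj_def)
    have "real (c1 QA PA X) \<le> real (c1 QA PA Y)" if "X \<subseteq> Y" for X Y
      unfolding c1 using that by (simp add: dim_subset fitting_space_mono)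
    moreover have "real (c2 QF QA (PA \<union> PF) m X) \<le> real (c2 QF QA (PA \<union> PF) m Y)" if "X \<subseteq> Y" for X Y
      unfolding c2 using that by (intro monoD[OF card_UN_mono])
    ultimately show "mono obj"
      unfolding obj_def using monoD[OF assms(5)] assms(7)
      by (intro monoI add_mono mult_left_mono) auto
    show "submodular obj"
      unfolding obj_def c1 c2
      by (intro submodular_add submodular_mult assms dim_fitting_space_submodular card_UN_submodular)
    show "0 < k" "greedy obj k S" by fact+
    show "card Sopt \<le> k" using assms(9) by (simp add: optimal_solution_def)
  qed
qed

end
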